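(* Consider systems of congruences on the sphere $S^2$ with arbitrary isometries of $S^2$ allowed as witnesses. If a system of congruences has a solution, or even a quasi-solution, in $S^2$ using nonmeager sets with the property of Baire, then the system is consistent. Consequently, if a system of congruences has a solution in $S^2$ using sets with the property of Baire (possibly meager), then it can be reduced to a consistent system by deleting zero or more (but not all) of the sets $A_1,\dots,A_r$ from all the congruences.
   Context: Fix a positive integer $r$. A congruence is a pair $(L,R)$ of subsets of the index set $I=\{1,\dots,r\}$, written formally $\bigcup_{k\in L}A_k\cong\bigcup_{k\in R}A_k$; a system of congruences is a finite list of pairs $(L_i,R_i)$, $i\le m$. Deleting the sets $A_k$, $k\in D$ (with $D\subsetneq I$) produces the system on the index set $I\setminus D$ given by the pairs $(L_i\setminus D,R_i\setminus D)$, $i\le m$. For a system on a nonempty finite index set $I$, write $S^c=I\setminus S$ and let $\preceq$ be the smallest transitive relation on subsets of $I$ such that $L\preceq R$ whenever $L\subseteq R$, and $L_i\preceq R_i$, $R_i\preceq L_i$, $L_i^c\preceq R_i^c$, $R_i^c\preceq L_i^c$ for all $i\le m$. The system is consistent if there are no $L,R$ with $R$ a proper subset of $L$ and $L\preceq R$. A solution to the system in $S^2$ is a sequence of pairwise disjoint sets $A_1,\dots,A_r$ with union $S^2$ such that for each $i\le m$ there is an isometry $\sigma_i$ of $S^2$ with $\sigma_i(\bigcup_{k\in L_i}A_k)=\bigcup_{k\in R_i}A_k$. A quasi-solution is a sequence $A_1,\dots,A_r$ of subsets of $S^2$ with pairwise meager intersections and comeager union such that for each $i\le m$ there is an isometry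 $\sigma_i$ of $S^2$ for which $\sigma_i(\bigcup_{k\in L_i}A_k)$ differs from $\bigcup_{k\in R_i}A_k$ by a meager set. A set has the property of Baire if it differs from an open set by a meager set. *)

theory Defs
  imports "HOL-Analysis.Analysis"
begin

section \<open>Systems of congruences\<close>

text \<open>The pair \<open>(L, R)\<close> stands for the formal congruence between the union of the
  \<open>A k\<close> with \<open>k \<in> L\<close> and the union of the \<open>A k\<close> with \<open>k \<in> R\<close>.\<close>

type_synonym congruence_system = "(nat set \<times> nat set) list"

definition system_on :: "nat set \<Rightarrow> congruence_system \<Rightarrow> bool" where
  "system_on I C \<longleftrightarrow> (\<forall>(L, R) \<in> set C. L \<subseteq> I \<and> R \<subseteq> I)"

definition delete_indices :: "nat set \<Rightarrow> congruence_system \<Rightarrow> congruence_system" where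
  "delete_indices D C = map (\<lambda>(L, R). (L - D, R - D)) C"

inductive congr_le :: "nat set \<Rightarrow> congruence_system \<Rightarrow> nat set \<Rightarrow> nat set \<Rightarrow> bool"
  for I C where
  subset: "L \<subseteq> R \<Longrightarrow> R \<subseteq> I \<Longrightarrow> congr_le I C L R"
| forward: "(L, R) \<in> set C \<Longrightarrow> congr_le I C L R"
| backward: "(L, R) \<in> set C \<Longrightarrow> congr_le I C R L"
| compl_forward: "(L, R) \<in> set C \<Longrightarrow> congr_le I C (I - L) (I - R)"
| compl_backward: "(L, R) \<in> set C \<Longrightarrow> congr_le I C (I - R) (I - L)"
| trans: "congr_le I C L M \<Longrightarrow> congr_le I C M R \<Longrightarrow> congr_le I C L R"

definition consistent :: "nat set \<Rightarrow> congruence_system \<Rightarrow> bool" where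
  "consistent I C \<longleftrightarrow>
     \<not> (\<exists>L R. L \<subseteq> I \<and> R \<subset> L \<and> congr_le I C L R)"


section \<open>Baire category in a topological space\<close>

definition nowhere_dense_in :: "'a topology \<Rightarrow> 'a set \<Rightarrow> bool" where
  "nowhere_dense_in X A \<longleftrightarrow>
     A \<subseteq> topspace X \<and> X interior_of (X closure_of A) = {}"

definition meager_in :: "'a topology \<Rightarrow> 'a set \<Rightarrow> bool" where
  "meager_in X A \<longleftrightarrow>
     (\<exists>F :: nat \<Rightarrow> 'a set. (\<forall>n. nowhere_dense_in X (F n)) \<and> A = (\<Union>n. F n))"

definition comeager_in :: "'a topology \<Rightarrow> 'a set \<Rightarrow> bool" where
  "comeager_in X A \<longleftrightarrow> A \<subseteq> topspace X \<and> meager_in X (topspace X - A)"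

definition baire_property_in :: "'a topology \<Rightarrow> 'a set \<Rightarrow> bool" where
  "baire_property_in X A \<longleftrightarrow>
     A \<subseteq> topspace X \<and> (\<exists>U. openin X U \<and> meager_in X (sym_diff A U))"


section \<open>Solutions and quasi-solutions on the sphere\<close>

abbreviation S2 :: "(real ^ 3) set" where
  "S2 \<equiv> sphere 0 1"

abbreviation S2_top :: "(real ^ 3) topology" where
  "S2_top \<equiv> top_of_set S2"

text \<open>Distances are those of the ambient space. The geodesic distance on the sphere is a
  strictly increasing function of them, so it has the same isometries. Values outside the
  sphere are irrelevant.\<close>

definition isometry_of :: "'a::metric_space set \<Rightarrow> ('a \<Rightarrow> 'a) \<Rightarrow> bool" where
  "isometry_of S f \<longleftrightarrow>
     f ` S = S \<and> (\<forall>x\<in>S. \<forall>y\<in>S. dist (f x) (f y) = dist x y)"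

definition is_solution ::
    "nat set \<Rightarrow> congruence_system \<Rightarrow> (nat \<Rightarrow> (real ^ 3) set) \<Rightarrow> bool" where
  "is_solution I C A \<longleftrightarrow>
     disjoint_family_on A I \<and> (\<Union>k\<in>I. A k) = S2 \<and>
     (\<forall>(L, R) \<in> set C. \<exists>\<sigma>. isometry_of S2 \<sigma> \<and>
        \<sigma> ` (\<Union>k\<in>L. A k) = (\<Union>k\<in>R. A k))"

definition is_quasi_solution ::
    "nat set \<Rightarrow> congruence_system \<Rightarrow> (nat \<Rightarrow> (real ^ 3) set) \<Rightarrow> bool" where
  "is_quasi_solution I C A \<longleftrightarrow>
     (\<forall>k\<in>I. A k \<subseteq> S2) \<and>
     (\<forall>j\<in>I. \<forall>k\<in>I. j \<noteq> k \<longrightarrow> meager_in S2_top (A j \<inter> A k)) \<and>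
     comeager_in S2_top (\<Union>k\<in>I. A k) \<and>
     (\<forall>(L, R) \<in> set C. \<exists>\<sigma>. isometry_of S2 \<sigma> \<and>
        meager_in S2_top (sym_diff (\<sigma> ` (\<Union>k\<in>L. A k)) (\<Union>k\<in>R. A k)))"

end

theory Submission
  imports Defs
begin

text \<open>Modulo meager sets, every relation \<open>L \<preceq> R\<close> of the system is witnessed by a single isometry
  that moves \<open>\<Union>\<^sub>L A\<^sub>k\<close> into \<open>\<Union>\<^sub>R A\<^sub>k\<close>: inclusions are witnessed by the identity, a congruence
  by its isometry or the inverse, the complementary congruence by the same isometry (since the
  \<open>A\<^sub>k\<close> partition the sphere up to a meager set), and transitivity composes isometries
  (\<open>congr_le_isometry\<close>).

  If the system were inconsistent, there would be an isometry \<open>\<sigma>\<close> compressing \<open>\<Union>\<^sub>L A\<^sub>k\<close> into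
  \<open>\<Union>\<^sub>R A\<^sub>k\<close> with \<open>R \<subset> L\<close>. For \<open>k \<in> L - R\<close>, the property of Baire provides a nonempty open
  set \<open>U\<close> equal to \<open>A\<^sub>k\<close> modulo a meager set. All the forward images \<open>\<sigma>\<^sup>n U\<close>, \<open>n \<ge> 1\<close>, lie
  almost inside \<open>\<Union>\<^sub>R A\<^sub>k\<close>, which almost misses \<open>U\<close>; as \<open>\<sigma>\<^sup>n U \<inter> U\<close> is open, Baire's
  theorem makes it empty. But an isometry of a compact space is recurrent: every point returns
  arbitrarily close to itself (\<open>isometry_recurrent\<close>). This contradiction is
  \<open>no_compression_mod_meager\<close>.

  For the second claim, delete the indices of the meager \<open>A\<^sub>k\<close>. The rest is a quasi-solution of the
  reduced system by nonmeager sets, and some index survives because the sphere is not meager.\<close>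

section \<open>Meager sets\<close>

lemma nowhere_dense_in_subset:
  assumes "nowhere_dense_in X B" "A \<subseteq> B"
  shows "nowhere_dense_in X A"
proof -
  have "X interior_of (X closure_of A) \<subseteq> X interior_of (X closure_of B)"
    using assms(2) by (intro interior_of_mono closure_of_mono)
  then show ?thesis
    using assms unfolding nowhere_dense_in_def by auto
qed

lemma meager_in_subset:
  assumes "meager_in X B" "A \<subseteq> B"
  shows "meager_in X A"
proof -
  obtain F :: "nat \<Rightarrow> _" where F: "\<And>n. nowhere_dense_in X (F n)" "B = (\<Union>n. F n)"
    using assms(1) unfolding meager_in_def by blast
  have "nowhere_dense_in X (F n \<inter> A)" for n
    using F(1) by (rule nowhere_dense_in_subset) auto
  moreover have "A = (\<Union>n. F n \<inter> A)"
    using F(2) assms(2) by auto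
  ultimately show ?thesis
    unfolding meager_in_def by (intro exI[of _ "\<lambda>n. F n \<inter> A"]) auto
qed

lemma meager_in_empty [simp]: "meager_in X {}"
  unfolding meager_in_def nowhere_dense_in_def by (intro exI[of _ "\<lambda>_. {}"]) auto

lemma meager_in_UN:
  fixes J :: "nat set"
  assumes "\<And>j. j \<in> J \<Longrightarrow> meager_in X (A j)"
  shows "meager_in X (\<Union>j\<in>J. A j)"
proof -
  have "meager_in X (if j \<in> J then A j else {})" for j
    using assms by simp
  then obtain F :: "nat \<Rightarrow> nat \<Rightarrow> _" where
    F: "\<And>j n. nowhere_dense_in X (F j n)" "\<And>j. (if j \<in> J then A j else {}) = (\<Union>n. F j n)"
    unfolding meager_in_def by metis
  have "(\<Union>j\<in>J. A j) = (\<Union>j. if j \<in> J then A j else {})"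
    by (auto split: if_splits)
  also have "\<dots> = (\<Union>p. F (fst p) (snd p))"
    unfolding F(2) by (auto; blast)
  also have "\<dots> = (\<Union>n. F (fst (prod_decode n)) (snd (prod_decode n)))"
    unfolding surj_prod_decode[symmetric] by (simp only: image_image)
  finally show ?thesis
    using F(1) unfolding meager_in_def
    by (intro exI[of _ "\<lambda>n. F (fst (prod_decode n)) (snd (prod_decode n))"]) auto
qed

lemma meager_in_Un:
  assumes "meager_in X A" "meager_in X B"
  shows "meager_in X (A \<union> B)"
proof -
  have "meager_in X (\<Union>j\<in>{0, 1::nat}. if j = 0 then A else B)"
    by (rule meager_in_UN) (use assms in auto)
  then show ?thesis by (simp add: Un_commute)
qed

lemma meager_in_homeomorphic_image:
  assumes "homeomorphic_map X X f" "meager_in X A"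
  shows "meager_in X (f ` A)"
proof -
  obtain F :: "nat \<Rightarrow> _" where F: "\<And>n. nowhere_dense_in X (F n)" "A = (\<Union>n. F n)"
    using assms(2) unfolding meager_in_def by blast
  have "nowhere_dense_in X (f ` F n)" for n
  proof -
    have FX: "F n \<subseteq> topspace X" and int: "X interior_of (X closure_of F n) = {}"
      using F(1)[of n] unfolding nowhere_dense_in_def by auto
    have "X interior_of (X closure_of (f ` F n)) = f ` (X interior_of (X closure_of F n))"
      using homeomorphic_map_closure_of[OF assms(1) FX]
        homeomorphic_map_interior_of[OF assms(1) closure_of_subset_topspace]
      by simp
    moreover have "f ` F n \<subseteq> topspace X"
      using FX homeomorphic_imp_surjective_map[OF assms(1)] by blast
    ultimately show ?thesis
      using int unfolding nowhere_dense_in_def by simp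
  qed
  then show ?thesis
    using F(2) unfolding meager_in_def by (intro exI[of _ "\<lambda>n. f ` F n"]) auto
qed

text \<open>Baire's theorem for the locally compact regular space \<open>S\<close>. It turns almost disjointness of
  open sets into disjointness.\<close>

lemma openin_meager_in_compact_empty:
  fixes S :: "'a::metric_space set"
  assumes S: "compact S"
    and U: "openin (top_of_set S) U" "meager_in (top_of_set S) U"
  shows "U = {}"
proof -
  let ?X = "top_of_set S"
  have "locally_compact_space ?X"
    using S by (intro compact_imp_locally_compact_space) (simp add: compact_space_subtopology)
  moreover have "regular_space ?X"
    by (intro metrizable_imp_regular_space metrizable_space_subtopology metrizable_space_euclidean)
  ultimately have X: "completely_metrizable_space ?X \<or> locally_compact_space ?X \<and> regular_space ?X"
    by simp
  obtain F :: "nat \<Rightarrow> _" where F: "\<And>n. nowhere_dense_in ?X (F n)" "U = (\<Union>n. F n)"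
    using U(2) unfolding meager_in_def by blast
  have "?X interior_of \<Union>(range (\<lambda>n. ?X closure_of F n)) = {}"
    by (rule Baire_category_alt[OF X]) (use F(1) in \<open>auto simp: nowhere_dense_in_def\<close>)
  moreover have "F n \<subseteq> ?X closure_of F n" for n
    using F(1)[of n] closure_of_subset unfolding nowhere_dense_in_def by blast
  then have "U \<subseteq> \<Union>(range (\<lambda>n. ?X closure_of F n))"
    unfolding F(2) by blast
  ultimately show ?thesis
    using interior_of_maximal[OF _ U(1)] by blast
qed

section \<open>Isometries of a compact set\<close>

lemma isometry_of_id: "isometry_of S id"
  unfolding isometry_of_def by simp

lemma isometry_of_compose:
  assumes "isometry_of S f" "isometry_of S g"
  shows "isometry_of S (g \<circ> f)"
proof -
  have "f ` S = S" "g ` S = S"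
    using assms by (auto simp: isometry_of_def)
  moreover have "f x \<in> S" if "x \<in> S" for x
    using that \<open>f ` S = S\<close> by blast
  ultimately show ?thesis
    using assms unfolding isometry_of_def image_comp[symmetric] by simp
qed

lemma isometry_of_funpow: "isometry_of S f \<Longrightarrow> isometry_of S (f ^^ n)"
  by (induction n) (simp_all add: isometry_of_id isometry_of_compose)

lemma isometry_of_inj_on:
  assumes "isometry_of S f"
  shows "inj_on f S"
  by (rule inj_onI) (metis assms dist_eq_0_iff isometry_of_def)

lemma isometry_of_inv_into:
  assumes "isometry_of S f"
  shows "isometry_of S (inv_into S f)"
proof -
  have S: "f ` S = S" and inj: "inj_on f S"
    using assms isometry_of_inj_on by (auto simp: isometry_of_def)
  have "inv_into S f ` S = S"
    using inj S inv_into_image_cancel[OF inj, of S] by simp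
  moreover have "dist (inv_into S f x) (inv_into S f y) = dist x y" if "x \<in> S" "y \<in> S" for x y
  proof -
    have "dist (f (inv_into S f x)) (f (inv_into S f y)) = dist (inv_into S f x) (inv_into S f y)"
      using assms that S inv_into_into[of _ f S] unfolding isometry_of_def by blast
    then show ?thesis
      using that S by (simp add: f_inv_into_f)
  qed
  ultimately show ?thesis
    unfolding isometry_of_def by blast
qed

lemma isometry_of_continuous_map:
  assumes "isometry_of S f"
  shows "continuous_map (top_of_set S) (top_of_set S) f"
proof -
  have "continuous_on S f"
    unfolding continuous_on_iff using assms unfolding isometry_of_def by metis
  then show ?thesis
    using assms by (auto simp: isometry_of_def)
qed

lemma isometry_of_homeomorphic_map:
  assumes "isometry_of S f"
  shows "homeomorphic_map (top_of_set S) (top_of_set S) f"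
proof -
  have "f ` S = S"
    using assms by (simp add: isometry_of_def)
  then have "homeomorphic_maps (top_of_set S) (top_of_set S) f (inv_into S f)"
    using isometry_of_continuous_map[OF assms]
      isometry_of_continuous_map[OF isometry_of_inv_into[OF assms]]
    unfolding homeomorphic_maps_def
    by (simp add: f_inv_into_f inv_into_f_f[OF isometry_of_inj_on[OF assms]])
  then show ?thesis
    using homeomorphic_map_maps by blast
qed

lemma meager_in_isometry_image:
  "isometry_of S f \<Longrightarrow> meager_in (top_of_set S) A \<Longrightarrow> meager_in (top_of_set S) (f ` A)"
  by (rule meager_in_homeomorphic_image[OF isometry_of_homeomorphic_map])

text \<open>Two points of an orbit come close by compactness; applying the isometry backwards moves the
  earlier one to the starting point without changing the distance.\<close>

lemma isometry_recurrent:
  assumes "compact S" "isometry_of S f" "x \<in> S" "e > 0"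
  obtains n where "n \<ge> 1" "dist ((f ^^ n) x) x < e"
proof -
  have inS: "(f ^^ n) x \<in> S" for n
    using isometry_of_funpow[OF assms(2), of n] assms(3) unfolding isometry_of_def by blast
  obtain l q where q: "strict_mono q" "((\<lambda>n. (f ^^ n) x) \<circ> q) \<longlonglongrightarrow> l"
    using assms(1) inS unfolding compact_def by metis
  from LIMSEQ_imp_Cauchy[OF q(2)] obtain N where
    N: "\<And>m n. m \<ge> N \<Longrightarrow> n \<ge> N \<Longrightarrow> dist ((f ^^ q m) x) ((f ^^ q n) x) < e"
    using assms(4) unfolding Cauchy_def comp_def by blast
  define m n where "m = q N" and "n = q (Suc N) - q N"
  have lt: "q N < q (Suc N)"
    using q(1) by (simp add: strict_mono_def)
  then have "(f ^^ q (Suc N)) x = (f ^^ m) ((f ^^ n) x)"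
    unfolding m_def n_def by (metis comp_apply funpow_add le_add_diff_inverse less_imp_le)
  then have "dist ((f ^^ n) x) x = dist ((f ^^ q (Suc N)) x) ((f ^^ q N) x)"
    using isometry_of_funpow[OF assms(2), of m] inS assms(3)
    unfolding isometry_of_def m_def by simp
  also have "\<dots> < e"
    by (rule N) auto
  finally show ?thesis
    using that[of n] lt unfolding n_def by simp
qed

text \<open>An isometry of a compact space cannot shrink a set by a nonmeager open piece: such a piece
  \<open>U\<close> could never meet its forward images.\<close>

lemma no_compression_mod_meager:
  fixes S :: "'a::metric_space set"
  assumes S: "compact S" and f: "isometry_of S f"
    and PQ: "P \<subseteq> Q" and fQ: "meager_in (top_of_set S) (f ` Q - P)"
    and U: "openin (top_of_set S) U"
    and UQ: "meager_in (top_of_set S) (U - Q)" and UP: "meager_in (top_of_set S) (U \<inter> P)"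
  shows "U = {}"
proof (rule ccontr)
  assume "U \<noteq> {}"
  then obtain x e where x: "x \<in> U" "x \<in> S" "e > 0" and ball: "\<And>y. y \<in> S \<Longrightarrow> dist y x < e \<Longrightarrow> y \<in> U"
    using U unfolding openin_euclidean_subtopology_iff by blast
  obtain n where n: "n \<ge> 1" "dist ((f ^^ n) x) x < e"
    using isometry_recurrent[OF S f x(2,3)] .
  note fn = isometry_of_funpow[OF f]
  have "(f ^^ n) x \<in> S"
    using fn[of n] x(2) unfolding isometry_of_def by blast
  then have meet: "(f ^^ n) x \<in> (f ^^ n) ` U \<inter> U"
    using ball n(2) x(1) by blast
  have image_Q: "meager_in (top_of_set S) (f ` V - P)"
    if "meager_in (top_of_set S) (V - Q)" for V
  proof (rule meager_in_subset)
    show "meager_in (top_of_set S) (f ` (V - Q) \<union> (f ` Q - P))"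
      by (intro meager_in_Un meager_in_isometry_image f that fQ)
  qed auto
  \<comment> \<open>Once inside \<open>P \<subseteq> Q\<close> modulo a meager set, the images stay there.\<close>
  have iterate: "meager_in (top_of_set S) ((f ^^ Suc i) ` U - P)" for i
  proof (induction i)
    case 0
    then show ?case using image_Q[OF UQ] by simp
  next
    case (Suc i)
    have "meager_in (top_of_set S) ((f ^^ Suc i) ` U - Q)"
      using Suc.IH by (rule meager_in_subset) (use PQ in auto)
    then have "meager_in (top_of_set S) (f ` ((f ^^ Suc i) ` U) - P)"
      by (rule image_Q)
    then show ?case
      by (simp add: image_comp)
  qed
  obtain i where i: "n = Suc i"
    using n(1) by (cases n) auto
  have "meager_in (top_of_set S) ((f ^^ n) ` U \<inter> U)"
    by (rule meager_in_subset[OF meager_in_Un[OF iterate[of i] UP]]) (auto simp: i)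
  moreover have "openin (top_of_set S) ((f ^^ n) ` U \<inter> U)"
    using homeomorphic_map_openness_eq[OF isometry_of_homeomorphic_map[OF fn]] U
    by (meson homeomorphic_imp_open_map isometry_of_homeomorphic_map fn open_map_def openin_Int)
  ultimately show False
    using openin_meager_in_compact_empty[OF S] meet by blast
qed

section \<open>Congruences modulo meager sets\<close>

lemma is_solution_imp_quasi_solution:
  assumes "is_solution I C A"
  shows "is_quasi_solution I C A"
proof -
  have S: "(\<Union>k\<in>I. A k) = S2" and "disjoint_family_on A I"
    using assms unfolding is_solution_def by auto
  then have "\<forall>j\<in>I. \<forall>k\<in>I. j \<noteq> k \<longrightarrow> meager_in S2_top (A j \<inter> A k)"
    by (simp add: disjoint_family_on_def)
  moreover have "\<exists>\<sigma>. isometry_of S2 \<sigma> \<and>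
        meager_in S2_top (sym_diff (\<sigma> ` (\<Union>k\<in>L. A k)) (\<Union>k\<in>R. A k))"
    if LR: "(L, R) \<in> set C" for L R
  proof -
    have "\<forall>(L, R) \<in> set C. \<exists>\<sigma>. isometry_of S2 \<sigma> \<and> \<sigma> ` (\<Union>k\<in>L. A k) = (\<Union>k\<in>R. A k)"
      using assms unfolding is_solution_def by (elim conjE)
    from bspec[OF this LR] obtain \<sigma> where "isometry_of S2 \<sigma>" "\<sigma> ` (\<Union>k\<in>L. A k) = (\<Union>k\<in>R. A k)"
      by auto
    then show ?thesis
      by (intro exI[of _ \<sigma>]) simp
  qed
  moreover have "\<forall>k\<in>I. A k \<subseteq> S2"
    using S by blast
  moreover have "comeager_in S2_top (\<Union>k\<in>I. A k)"
    unfolding comeager_in_def S by simp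
  ultimately show ?thesis
    unfolding is_quasi_solution_def by blast
qed

lemma quasi_solutionD:
  assumes "is_quasi_solution I C A"
  shows quasi_solution_subset: "k \<in> I \<Longrightarrow> A k \<subseteq> S2"
    and quasi_solution_inter: "j \<in> I \<Longrightarrow> k \<in> I \<Longrightarrow> j \<noteq> k \<Longrightarrow> meager_in S2_top (A j \<inter> A k)"
    and quasi_solution_cover: "meager_in S2_top (S2 - (\<Union>k\<in>I. A k))"
    and quasi_solution_congruence: "(L, R) \<in> set C \<Longrightarrow> \<exists>\<sigma>. isometry_of S2 \<sigma> \<and>
          meager_in S2_top (sym_diff (\<sigma> ` (\<Union>k\<in>L. A k)) (\<Union>k\<in>R. A k))"
proof -
  from assms have *: "\<forall>k\<in>I. A k \<subseteq> S2"
    "\<forall>j\<in>I. \<forall>k\<in>I. j \<noteq> k \<longrightarrow> meager_in S2_top (A j \<inter> A k)"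
    "comeager_in S2_top (\<Union>k\<in>I. A k)"
    and **: "\<forall>(L, R) \<in> set C. \<exists>\<sigma>. isometry_of S2 \<sigma> \<and>
          meager_in S2_top (sym_diff (\<sigma> ` (\<Union>k\<in>L. A k)) (\<Union>k\<in>R. A k))"
    unfolding is_quasi_solution_def by - (elim conjE; assumption)+
  show "k \<in> I \<Longrightarrow> A k \<subseteq> S2"
    and "j \<in> I \<Longrightarrow> k \<in> I \<Longrightarrow> j \<noteq> k \<Longrightarrow> meager_in S2_top (A j \<inter> A k)"
    using * by simp_all
  show "meager_in S2_top (S2 - (\<Union>k\<in>I. A k))"
    using * unfolding comeager_in_def by simp
  show "\<exists>\<sigma>. isometry_of S2 \<sigma> \<and>
          meager_in S2_top (sym_diff (\<sigma> ` (\<Union>k\<in>L. A k)) (\<Union>k\<in>R. A k))"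
    if "(L, R) \<in> set C"
    using bspec[OF ** that] by simp
qed

text \<open>This makes the relation of congruence modulo a meager set symmetric.\<close>

lemma isometry_congruence_inverse:
  fixes f :: "'a::metric_space \<Rightarrow> 'a"
  assumes f: "isometry_of S f" and P: "P \<subseteq> S"
    and m: "meager_in (top_of_set S) (sym_diff (f ` P) Q)"
  shows "meager_in (top_of_set S) (sym_diff (inv_into S f ` Q) P)"
proof (rule meager_in_subset)
  show "meager_in (top_of_set S) (inv_into S f ` sym_diff (f ` P) Q)"
    by (intro meager_in_isometry_image isometry_of_inv_into f m)
  have "inv_into S f ` (f ` P) = P"
    using isometry_of_inj_on[OF f] P by (rule inv_into_image_cancel)
  moreover have "sym_diff (g ` Q) (g ` P') \<subseteq> g ` sym_diff P' Q" for g :: "'a \<Rightarrow> 'a" and P'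
    by blast
  ultimately show "sym_diff (inv_into S f ` Q) P \<subseteq> inv_into S f ` sym_diff (f ` P) Q"
    by metis
qed

lemma quasi_solution_overlap_meager:
  assumes A: "is_quasi_solution I C A" and "L \<subseteq> I" "R \<subseteq> I" "L \<inter> R = {}"
  shows "meager_in S2_top ((\<Union>k\<in>L. A k) \<inter> (\<Union>k\<in>R. A k))"
proof -
  have "meager_in S2_top (\<Union>j\<in>L. \<Union>k\<in>R. A j \<inter> A k)"
  proof (intro meager_in_UN)
    fix j k assume "j \<in> L" "k \<in> R"
    then have "j \<in> I" "k \<in> I" "j \<noteq> k"
      using assms(2-4) by auto
    then show "meager_in S2_top (A j \<inter> A k)"
      using A quasi_solution_inter by blast
  qed
  then show ?thesis
    by (rule meager_in_subset) auto
qed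

text \<open>A point of \<open>\<sigma> (\<Union>\<^bsub>I - L\<^esub> A\<^sub>k)\<close> outside \<open>\<Union>\<^bsub>I - R\<^esub> A\<^sub>k\<close> is either missed by all the \<open>A\<^sub>k\<close>, or
  lies in the image of an overlap, or witnesses that \<open>\<sigma>\<close> fails to map \<open>\<Union>\<^sub>L A\<^sub>k\<close> onto
  \<open>\<Union>\<^sub>R A\<^sub>k\<close>.\<close>

lemma congruence_complement:
  assumes A: "is_quasi_solution I C A" and L: "L \<subseteq> I"
    and \<sigma>: "isometry_of S2 \<sigma>"
    and m: "meager_in S2_top (sym_diff (\<sigma> ` (\<Union>k\<in>L. A k)) (\<Union>k\<in>R. A k))"
  shows "meager_in S2_top (\<sigma> ` (\<Union>k\<in>I - L. A k) - (\<Union>k\<in>I - R. A k))"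
proof (rule meager_in_subset)
  have "meager_in S2_top (S2 - (\<Union>k\<in>I. A k))"
    using A by (rule quasi_solution_cover)
  moreover have "meager_in S2_top ((\<Union>k\<in>L. A k) \<inter> (\<Union>k\<in>I - L. A k))"
    using A L by (rule quasi_solution_overlap_meager) auto
  ultimately show "meager_in S2_top ((S2 - (\<Union>k\<in>I. A k))
      \<union> \<sigma> ` ((\<Union>k\<in>L. A k) \<inter> (\<Union>k\<in>I - L. A k))
      \<union> sym_diff (\<sigma> ` (\<Union>k\<in>L. A k)) (\<Union>k\<in>R. A k))"
    by (intro meager_in_Un meager_in_isometry_image \<sigma> m)
  have "(\<Union>k\<in>I. A k) \<subseteq> S2"
    using quasi_solution_subset[OF A] by blast
  then have "\<sigma> ` (\<Union>k\<in>I - L. A k) \<subseteq> S2"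
    using \<sigma> unfolding isometry_of_def by fastforce
  then show "\<sigma> ` (\<Union>k\<in>I - L. A k) - (\<Union>k\<in>I - R. A k) \<subseteq> (S2 - (\<Union>k\<in>I. A k))
      \<union> \<sigma> ` ((\<Union>k\<in>L. A k) \<inter> (\<Union>k\<in>I - L. A k))
      \<union> sym_diff (\<sigma> ` (\<Union>k\<in>L. A k)) (\<Union>k\<in>R. A k)"
  proof (intro subsetI)
    fix y assume sub: "\<sigma> ` (\<Union>k\<in>I - L. A k) \<subseteq> S2"
      and y: "y \<in> \<sigma> ` (\<Union>k\<in>I - L. A k) - (\<Union>k\<in>I - R. A k)"
    then obtain x where x: "x \<in> (\<Union>k\<in>I - L. A k)" "y = \<sigma> x" and "y \<in> S2"
      by blast
    have "y \<in> (\<Union>k\<in>R. A k)" if "y \<in> (\<Union>k\<in>I. A k)"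
      using that y by blast
    moreover have "(\<exists>z\<in>(\<Union>k\<in>L. A k). y = \<sigma> z) \<Longrightarrow> x \<in> (\<Union>k\<in>L. A k)"
    proof -
      assume "\<exists>z\<in>(\<Union>k\<in>L. A k). y = \<sigma> z"
      then obtain z where z: "z \<in> (\<Union>k\<in>L. A k)" "\<sigma> x = \<sigma> z"
        using x(2) by auto
      moreover have "x \<in> S2" "z \<in> S2"
        using x(1) z(1) L \<open>(\<Union>k\<in>I. A k) \<subseteq> S2\<close> by blast+
      ultimately show ?thesis
        using isometry_of_inj_on[OF \<sigma>] by (metis inj_onD)
    qed
    ultimately show "y \<in> (S2 - (\<Union>k\<in>I. A k))
      \<union> \<sigma> ` ((\<Union>k\<in>L. A k) \<inter> (\<Union>k\<in>I - L. A k))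
      \<union> sym_diff (\<sigma> ` (\<Union>k\<in>L. A k)) (\<Union>k\<in>R. A k)"
      using x \<open>y \<in> S2\<close> by blast
  qed
qed

text \<open>Only the inclusion is kept: exact images modulo meager sets are lost in the subset rule, but
  almost inclusion of an image composes, and it is all that a compression argument needs.\<close>

lemma congr_le_isometry:
  assumes "system_on I C" "is_quasi_solution I C A" "congr_le I C L R"
  shows "\<exists>\<sigma>. isometry_of S2 \<sigma> \<and> meager_in S2_top (\<sigma> ` (\<Union>k\<in>L. A k) - (\<Union>k\<in>R. A k))"
proof -
  have sys: "L \<subseteq> I \<and> R \<subseteq> I" if "(L, R) \<in> set C" for L R
    using assms(1) that unfolding system_on_def by auto
  have sub: "(\<Union>k\<in>L. A k) \<subseteq> S2" if "L \<subseteq> I" for L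
    using quasi_solution_subset[OF assms(2)] that by blast
  have fwd: "\<exists>\<sigma>. isometry_of S2 \<sigma> \<and>
      meager_in S2_top (sym_diff (\<sigma> ` (\<Union>k\<in>L. A k)) (\<Union>k\<in>R. A k))"
    if "(L, R) \<in> set C" for L R
    using assms(2) that by (rule quasi_solution_congruence)
  have bwd: "\<exists>\<sigma>. isometry_of S2 \<sigma> \<and>
      meager_in S2_top (sym_diff (\<sigma> ` (\<Union>k\<in>R. A k)) (\<Union>k\<in>L. A k))"
    if LR: "(L, R) \<in> set C" for L R
  proof -
    obtain \<sigma> where \<sigma>: "isometry_of S2 \<sigma>"
      "meager_in S2_top (sym_diff (\<sigma> ` (\<Union>k\<in>L. A k)) (\<Union>k\<in>R. A k))"
      using fwd[OF LR] by blast
    show ?thesis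
      using isometry_of_inv_into[OF \<sigma>(1)]
        isometry_congruence_inverse[OF \<sigma>(1) _ \<sigma>(2)] sub sys[OF LR] by blast
  qed
  from assms(3) show ?thesis
  proof induction
    case (subset L R)
    then have "id ` (\<Union>k\<in>L. A k) - (\<Union>k\<in>R. A k) = {}"
      by auto
    then show ?case
      using isometry_of_id by (metis meager_in_empty)
  next
    case (forward L R)
    then show ?case
      using fwd meager_in_subset[OF _ Un_upper1] by blast
  next
    case (backward L R)
    then show ?case
      using bwd meager_in_subset[OF _ Un_upper1] by blast
  next
    case (compl_forward L R)
    then show ?case
      using fwd[of L R] sys[of L R] congruence_complement[OF assms(2)] by blast
  next
    case (compl_backward L R)
    then show ?case
      using bwd[of L R] sys[of L R] congruence_complement[OF assms(2)] by blast
  next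
    case (trans L M R)
    then obtain \<sigma> \<tau> where \<sigma>: "isometry_of S2 \<sigma>" "meager_in S2_top (\<sigma> ` (\<Union>k\<in>L. A k) - (\<Union>k\<in>M. A k))"
      and \<tau>: "isometry_of S2 \<tau>" "meager_in S2_top (\<tau> ` (\<Union>k\<in>M. A k) - (\<Union>k\<in>R. A k))"
      by blast
    have "meager_in S2_top (\<tau> ` (\<sigma> ` (\<Union>k\<in>L. A k) - (\<Union>k\<in>M. A k)) \<union>
        (\<tau> ` (\<Union>k\<in>M. A k) - (\<Union>k\<in>R. A k)))"
      by (intro meager_in_Un meager_in_isometry_image \<sigma> \<tau>)
    moreover have "(\<tau> \<circ> \<sigma>) ` P - R' \<subseteq> \<tau> ` (\<sigma> ` P - Q) \<union> (\<tau> ` Q - R')" for P Q R'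
      by auto
    ultimately have "meager_in S2_top ((\<tau> \<circ> \<sigma>) ` (\<Union>k\<in>L. A k) - (\<Union>k\<in>R. A k))"
      by (rule meager_in_subset)
    then show ?case
      using isometry_of_compose[OF \<sigma>(1) \<tau>(1)] by blast
  qed
qed

section \<open>Consistency\<close>

lemma quasi_solution_imp_consistent:
  assumes C: "system_on I C" and A: "is_quasi_solution I C A"
    and nonmeager: "\<And>k. k \<in> I \<Longrightarrow> \<not> meager_in S2_top (A k)"
    and baire: "\<And>k. k \<in> I \<Longrightarrow> baire_property_in S2_top (A k)"
  shows "consistent I C"
  unfolding consistent_def
proof
  assume "\<exists>L R. L \<subseteq> I \<and> R \<subset> L \<and> congr_le I C L R"
  then obtain L R k where LR: "L \<subseteq> I" "R \<subset> L" "congr_le I C L R" and k: "k \<in> L" "k \<notin> R"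
    by blast
  obtain \<sigma> where \<sigma>: "isometry_of S2 \<sigma>" "meager_in S2_top (\<sigma> ` (\<Union>k\<in>L. A k) - (\<Union>k\<in>R. A k))"
    using congr_le_isometry[OF C A LR(3)] by blast
  have "k \<in> I"
    using k(1) LR(1) by blast
  then obtain U where U: "openin S2_top U" "meager_in S2_top (sym_diff (A k) U)"
    using baire unfolding baire_property_in_def by blast
  have UA: "meager_in S2_top (U - A k)"
    using U(2) by (rule meager_in_subset) auto
  have AR: "meager_in S2_top ((\<Union>j\<in>{k}. A j) \<inter> (\<Union>j\<in>R. A j))"
    using A by (rule quasi_solution_overlap_meager) (use LR k \<open>k \<in> I\<close> in auto)
  have "U = {}"
  proof (rule no_compression_mod_meager[OF _ \<sigma>(1) _ \<sigma>(2) U(1)])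
    show "meager_in S2_top (U - (\<Union>j\<in>L. A j))"
      using UA by (rule meager_in_subset) (use k in auto)
    show "meager_in S2_top (U \<inter> (\<Union>j\<in>R. A j))"
      by (rule meager_in_subset[OF meager_in_Un[OF UA AR]]) auto
  qed (use LR(2) in auto)
  then show False
    using U(2) nonmeager[OF \<open>k \<in> I\<close>] by simp
qed

lemma system_on_delete_indices:
  assumes "system_on I C"
  shows "system_on (I - D) (delete_indices D C)"
  using assms unfolding system_on_def delete_indices_def by fastforce

text \<open>All deleted indices together contribute a meager set, and so does its image under each
  witnessing isometry, so the same isometries serve the reduced system. An exact solution becomes
  only a quasi-solution, which is why consistency is proved for quasi-solutions.\<close>

lemma quasi_solution_delete_meager:
  assumes A: "is_quasi_solution I C A" and D: "\<And>k. k \<in> D \<Longrightarrow> meager_in S2_top (A k)"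
  shows "is_quasi_solution (I - D) (delete_indices D C) A"
proof -
  have mD: "meager_in S2_top (\<Union>k\<in>D. A k)"
    using D by (rule meager_in_UN)
  have "meager_in S2_top ((S2 - (\<Union>k\<in>I. A k)) \<union> (\<Union>k\<in>D. A k))"
    by (intro meager_in_Un quasi_solution_cover[OF A] mD)
  then have m: "meager_in S2_top (S2 - (\<Union>k\<in>I - D. A k))"
    by (rule meager_in_subset) auto
  have c: "\<exists>\<sigma>. isometry_of S2 \<sigma> \<and>
      meager_in S2_top (sym_diff (\<sigma> ` (\<Union>k\<in>L'. A k)) (\<Union>k\<in>R'. A k))"
    if LR': "(L', R') \<in> set (delete_indices D C)" for L' R'
  proof -
    obtain L R where LR: "(L, R) \<in> set C" "L' = L - D" "R' = R - D"
      using LR' unfolding delete_indices_def by auto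
    then obtain \<sigma> where \<sigma>: "isometry_of S2 \<sigma>"
      "meager_in S2_top (sym_diff (\<sigma> ` (\<Union>k\<in>L. A k)) (\<Union>k\<in>R. A k))"
      using quasi_solution_congruence[OF A] by blast
    have "meager_in S2_top (sym_diff (\<sigma> ` (\<Union>k\<in>L. A k)) (\<Union>k\<in>R. A k)
        \<union> \<sigma> ` (\<Union>k\<in>D. A k) \<union> (\<Union>k\<in>D. A k))"
      by (intro meager_in_Un meager_in_isometry_image \<sigma> mD)
    then have "meager_in S2_top (sym_diff (\<sigma> ` (\<Union>k\<in>L'. A k)) (\<Union>k\<in>R'. A k))"
    proof (rule meager_in_subset)
      have "(\<Union>k\<in>L. A k) \<union> (\<Union>k\<in>D. A k) = (\<Union>k\<in>L'. A k) \<union> (\<Union>k\<in>D. A k)"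
        unfolding LR by blast
      then have "\<sigma> ` (\<Union>k\<in>L. A k) \<union> \<sigma> ` (\<Union>k\<in>D. A k)
          = \<sigma> ` (\<Union>k\<in>L'. A k) \<union> \<sigma> ` (\<Union>k\<in>D. A k)"
        by (simp only: image_Un[symmetric])
      moreover have "(\<Union>k\<in>R. A k) \<union> (\<Union>k\<in>D. A k) = (\<Union>k\<in>R'. A k) \<union> (\<Union>k\<in>D. A k)"
        unfolding LR by blast
      moreover have "sym_diff P' Q' \<subseteq> sym_diff P Q \<union> E \<union> F"
        if "P \<union> E = P' \<union> E" "Q \<union> F = Q' \<union> F" for P P' Q Q' E F :: "(real ^ 3) set"
        using that by blast
      ultimately show "sym_diff (\<sigma> ` (\<Union>k\<in>L'. A k)) (\<Union>k\<in>R'. A k)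
          \<subseteq> sym_diff (\<sigma> ` (\<Union>k\<in>L. A k)) (\<Union>k\<in>R. A k) \<union> \<sigma> ` (\<Union>k\<in>D. A k) \<union> (\<Union>k\<in>D. A k)"
        by metis
    qed
    then show ?thesis
      using \<sigma>(1) by blast
  qed
  have "(\<Union>k\<in>I - D. A k) \<subseteq> S2"
    using quasi_solution_subset[OF A] by blast
  then have "comeager_in S2_top (\<Union>k\<in>I - D. A k)"
    using m unfolding comeager_in_def by simp
  moreover have "\<forall>k\<in>I - D. A k \<subseteq> S2"
    "\<forall>j\<in>I - D. \<forall>k\<in>I - D. j \<noteq> k \<longrightarrow> meager_in S2_top (A j \<inter> A k)"
    using quasi_solution_subset[OF A] quasi_solution_inter[OF A] by auto
  ultimately show ?thesis
    unfolding is_quasi_solution_def using c by blast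
qed

lemma S2_not_meager: "\<not> meager_in S2_top S2"
  using openin_meager_in_compact_empty[of S2 S2] by fastforce

theorem mainTheorem7:
  fixes r :: nat and C :: congruence_system
  assumes "r \<ge> 1" and "system_on {1..r} C"
  shows "((\<exists>A. (is_solution {1..r} C A \<or> is_quasi_solution {1..r} C A) \<and>
               (\<forall>k\<in>{1..r}. \<not> meager_in S2_top (A k) \<and> baire_property_in S2_top (A k)))
            \<longrightarrow> consistent {1..r} C) \<and>
         ((\<exists>A. is_solution {1..r} C A \<and> (\<forall>k\<in>{1..r}. baire_property_in S2_top (A k)))
            \<longrightarrow> (\<exists>D. D \<subset> {1..r} \<and> consistent ({1..r} - D) (delete_indices D C)))"
proof (intro conjI impI; elim exE conjE)
  fix A
  assume "is_solution {1..r} C A \<or> is_quasi_solution {1..r} C A"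
    and "\<forall>k\<in>{1..r}. \<not> meager_in S2_top (A k) \<and> baire_property_in S2_top (A k)"
  then show "consistent {1..r} C"
    using assms(2) is_solution_imp_quasi_solution quasi_solution_imp_consistent by blast
next
  fix A
  assume A: "is_solution {1..r} C A" and baire: "\<forall>k\<in>{1..r}. baire_property_in S2_top (A k)"
  define D where "D = {k \<in> {1..r}. meager_in S2_top (A k)}"
  have "D \<noteq> {1..r}"
  proof
    assume eq: "D = {1..r}"
    have "meager_in S2_top (\<Union>k\<in>D. A k)"
      by (rule meager_in_UN) (simp add: D_def)
    moreover have "(\<Union>k\<in>{1..r}. A k) = S2"
      using A unfolding is_solution_def by (elim conjE)
    ultimately show False
      using S2_not_meager unfolding eq by simp
  qed
  then have "D \<subset> {1..r}"
    unfolding D_def by blast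
  moreover have "consistent ({1..r} - D) (delete_indices D C)"
  proof (rule quasi_solution_imp_consistent)
    show "is_quasi_solution ({1..r} - D) (delete_indices D C) A"
      using is_solution_imp_quasi_solution[OF A]
      by (rule quasi_solution_delete_meager) (auto simp: D_def)
  qed (use assms(2) baire in \<open>auto simp: D_def intro: system_on_delete_indices\<close>)
  ultimately show "\<exists>D. D \<subset> {1..r} \<and> consistent ({1..r} - D) (delete_indices D C)"
    by blast
qed

end
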